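(* Let $V$ be a real or complex super Hilbert space. For any closed $B$-isotropic subspace $L\subset V$, there exists a unique partial isometry $u\colon V^+\to V^-$ such that $L=\mathrm{graph}'(u)$. Conversely, for every partial isometry $u\colon V^+\to V^-$, $\mathrm{graph}'(u)$ is a closed $B$-isotropic subspace of $V$. Moreover, a closed $B$-isotropic subspace $L=\mathrm{graph}'(u)$ is a sub-Lagrangian if and only if $u$ is Fredholm, and a Lagrangian if and only if $u$ is unitary.
   Context: A super Hilbert space is a Hilbert space $V$ with an orthogonal decomposition $V=V^+\oplus V^-$; its grading operator $\Gamma$ is $\pm1$ on $V^\pm$, and $B(x,y)=\langle\Gamma x,y\rangle$. A subspace $L\subset V$ is $B$-isotropic if $B(x,y)=0$ for all $x,y\in L$. A sub-Lagrangian is a $B$-isotropic subspace $L$ such that $L+\Gamma L$ has finite codimension in $V$; it is a Lagrangian if $L+\Gamma L=V$. For an operator $A\colon V^+\to V^-$, $\mathrm{graph}(A)=\{x+Ax\mid x\in V^+\}\subset V$ and $\mathrm{graph}'(A)=\mathrm{graph}(A)\cap\ker(A)^\perp$, where $\ker(A)\subset V^+\subset V$ and the orthogonal complement is taken in $V$. *)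

theory Defs
  imports Complex_Main "HOL-Library.FuncSet"
begin

text \<open>
  Scalars that are either real or complex. The lemma \<open>real_or_complex_cases\<close> below shows
  that the class has no further models.
\<close>

class real_or_complex = real_normed_field +
  fixes conj :: "'a \<Rightarrow> 'a"
  assumes conj_add: "conj (x + y) = conj x + conj y"
    and conj_mult: "conj (x * y) = conj x * conj y"
    and conj_conj: "conj (conj x) = x"
    and mult_conj_scaleR: "x * conj x = (norm x)\<^sup>2 *\<^sub>R 1"

instantiation real :: real_or_complex
begin
definition conj_real :: "real \<Rightarrow> real" where "conj_real x = x"
instance by standard (simp_all add: conj_real_def power2_eq_square)
end

instantiation complex :: real_or_complex
begin
definition conj_complex :: "complex \<Rightarrow> complex" where "conj_complex = cnj"
instance by standard (simp_all add: conj_complex_def scaleR_conv_of_real flip: complex_norm_square)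
end

lemma mult_conj: "x * conj x = of_real ((norm x)\<^sup>2)" for x :: "'a::real_or_complex"
  by (simp add: mult_conj_scaleR of_real_def)

lemma conj_fixed_real:
  fixes x :: "'a::real_or_complex"
  assumes "conj x = x"
  shows "x \<in> \<real>"
proof -
  have "x\<^sup>2 = (of_real (norm x))\<^sup>2"
    using mult_conj[of x] assms by (simp add: power2_eq_square)
  then have "x = of_real (norm x) \<or> x = of_real (- norm x)" by (simp add: power2_eq_iff)
  then show ?thesis by (metis Reals_of_real)
qed

lemma real_or_complex_cases:
  "(\<forall>x::'a::real_or_complex. x \<in> \<real>) \<or>
   (\<exists>i::'a. i\<^sup>2 = -1 \<and> conj i = - i \<and> (\<forall>x. \<exists>a b. x = of_real a + of_real b * i))"
proof (cases "\<forall>x::'a. x \<in> \<real>")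
  case False
  have conj0: "conj (0::'a) = 0" using conj_add[of "0::'a" 0] by simp
  have conj_minus: "conj (- x) = - conj x" for x :: 'a
    using conj_add[of x "- x"] conj0 by (metis add.right_inverse minus_unique)
  have conj_diff: "conj (x - y) = conj x - conj y" for x y :: 'a
    using conj_add[of x "- y"] conj_minus by simp
  have quot: "x / y \<in> \<real>" if "conj x = - x" "conj y = - y" "y \<noteq> 0" for x y :: 'a
  proof (rule conj_fixed_real)
    have "conj (x / y) * conj y = conj x" using conj_mult[of "x / y" y] that by simp
    then show "conj (x / y) = x / y" using that by (simp add: field_simps)
  qed
  have sum: "x + conj x \<in> \<real>" for x :: 'a
    by (rule conj_fixed_real) (simp add: conj_add conj_conj add.commute)
  have anti: "conj (x - conj x) = - (x - conj x)" for x :: 'a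
    by (simp add: conj_diff conj_conj)
  obtain z :: 'a where z: "z \<notin> \<real>" using False by blast
  define y where "y = z - conj z"
  have y0: "y \<noteq> 0" using conj_fixed_real[of z] z by (auto simp: y_def)
  have cy: "conj y = - y" unfolding y_def by (rule anti)
  define n where "n = norm y"
  have n0: "n \<noteq> 0" using y0 by (simp add: n_def)
  define i where "i = y / of_real n"
  have y2: "y\<^sup>2 = - of_real (n\<^sup>2)"
    using mult_conj[of y] cy unfolding n_def power2_eq_square
    by (metis minus_minus mult_minus_right)
  have i2: "i\<^sup>2 = -1"
    using n0 y2 by (simp add: i_def power_divide)
  have i0: "i \<noteq> 0" using y0 n0 by (simp add: i_def)
  have "conj i * of_real n = - y"
  proof -
    have cn: "conj (of_real n) = (of_real n :: 'a)"
    proof -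
      have "(of_real n :: 'a) * conj (of_real n) = of_real n * of_real n"
        using mult_conj[of "of_real n :: 'a"] by (simp add: power2_eq_square flip: of_real_mult)
      then show ?thesis using n0 by simp
    qed
    have "conj (i * of_real n) = conj y" using n0 by (simp add: i_def)
    then show ?thesis by (simp add: conj_mult cn cy)
  qed
  then have ci: "conj i = - i" using n0 by (simp add: i_def field_simps)
  have "\<exists>a b. x = of_real a + of_real b * i" for x
  proof -
    obtain a where a: "x + conj x = of_real a" using sum[of x] by (auto elim: Reals_cases)
    obtain b where b: "(x - conj x) / i = of_real b"
      using quot[OF anti ci i0, of x] by (auto elim: Reals_cases)
    have "x - conj x = of_real b * i" using b i0 by (simp add: field_simps)
    then have "x + x = of_real a + of_real b * i" using a
      by (metis add.commute add_diff_cancel_right' add_diff_eq diff_add_cancel)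
    then have "x = of_real (a / 2) + of_real (b / 2) * i" by (simp add: field_simps)
    then show ?thesis by blast
  qed
  then show ?thesis using i2 ci by blast
qed auto

text \<open>
  The underlying space is a whole type; completeness and the topology come from the class
  \<^class>\<open>banach\<close>, whose norm is required to be the one of the inner product. The inner
  product is linear in its first argument.
\<close>

locale hilbert_space = vector_space scale
  for scale :: "'k::real_or_complex \<Rightarrow> 'v::banach \<Rightarrow> 'v" +
  fixes ip :: "'v \<Rightarrow> 'v \<Rightarrow> 'k"
  assumes scale_of_real: "scale (of_real r) x = r *\<^sub>R x"
    and ip_add_left: "ip (x + y) z = ip x z + ip y z"
    and ip_scale_left: "ip (scale c x) y = c * ip x y"
    and ip_conj_sym: "ip y x = conj (ip x y)"
    and ip_self: "ip x x = of_real ((norm x)\<^sup>2)"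
begin

definition orth_compl :: "'v set \<Rightarrow> 'v set" where
  "orth_compl S = {x. \<forall>y\<in>S. ip x y = 0}"

definition finite_dim :: "'v set \<Rightarrow> bool" where
  "finite_dim W \<longleftrightarrow> (\<exists>F. finite F \<and> span F = W)"

text \<open>For subspaces \<open>W \<subseteq> U\<close>: the (algebraic) quotient \<open>U / W\<close> is finite-dimensional.\<close>

definition finite_codim_in :: "'v set \<Rightarrow> 'v set \<Rightarrow> bool" where
  "finite_codim_in W U \<longleftrightarrow> (\<exists>F. finite F \<and> F \<subseteq> U \<and> span (W \<union> F) = U)"

text \<open>
  Operators between subspaces \<open>X\<close> and \<open>Y\<close> are functions in \<open>X \<rightarrow>\<^sub>E Y\<close>, so that equality of
  functions is equality of operators.
\<close>

definition bounded_operator :: "'v set \<Rightarrow> 'v set \<Rightarrow> ('v \<Rightarrow> 'v) \<Rightarrow> bool" where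
  "bounded_operator X Y A \<longleftrightarrow>
     A \<in> X \<rightarrow>\<^sub>E Y \<and>
     (\<forall>x\<in>X. \<forall>y\<in>X. A (x + y) = A x + A y) \<and>
     (\<forall>c. \<forall>x\<in>X. A (scale c x) = scale c (A x)) \<and>
     (\<exists>K. \<forall>x\<in>X. norm (A x) \<le> K * norm x)"

definition ker :: "'v set \<Rightarrow> ('v \<Rightarrow> 'v) \<Rightarrow> 'v set" where
  "ker X A = {x \<in> X. A x = 0}"

definition partial_isometry :: "'v set \<Rightarrow> 'v set \<Rightarrow> ('v \<Rightarrow> 'v) \<Rightarrow> bool" where
  "partial_isometry X Y u \<longleftrightarrow>
     bounded_operator X Y u \<and> (\<forall>x \<in> X \<inter> orth_compl (ker X u). norm (u x) = norm x)"

text \<open>Closedness of the range is automatic for bounded operators with finite-dimensional cokernel.\<close>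

definition fredholm :: "'v set \<Rightarrow> 'v set \<Rightarrow> ('v \<Rightarrow> 'v) \<Rightarrow> bool" where
  "fredholm X Y A \<longleftrightarrow>
     bounded_operator X Y A \<and> finite_dim (ker X A) \<and> finite_codim_in (A ` X) Y"

definition unitary :: "'v set \<Rightarrow> 'v set \<Rightarrow> ('v \<Rightarrow> 'v) \<Rightarrow> bool" where
  "unitary X Y u \<longleftrightarrow>
     bounded_operator X Y u \<and> (\<forall>x\<in>X. \<forall>y\<in>X. ip (u x) (u y) = ip x y) \<and> u ` X = Y"

end

locale super_hilbert_space = hilbert_space scale ip
  for scale :: "'k::real_or_complex \<Rightarrow> 'v::banach \<Rightarrow> 'v" and ip :: "'v \<Rightarrow> 'v \<Rightarrow> 'k" +
  fixes Vp Vm :: "'v set"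
  assumes subspace_Vp: "module.subspace scale Vp"
    and subspace_Vm: "module.subspace scale Vm"
    and orthogonal: "x \<in> Vp \<Longrightarrow> y \<in> Vm \<Longrightarrow> ip x y = 0"
    and decomposition: "\<exists>x\<in>Vp. \<exists>y\<in>Vm. v = x + y"
begin

definition grading :: "'v \<Rightarrow> 'v" where
  "grading v = (THE w. \<exists>x\<in>Vp. \<exists>y\<in>Vm. v = x + y \<and> w = x - y)"

lemma grading_add:
  assumes "x \<in> Vp" "y \<in> Vm"
  shows "grading (x + y) = x - y"
  unfolding grading_def
proof (rule the_equality)
  fix w assume "\<exists>x'\<in>Vp. \<exists>y'\<in>Vm. x + y = x' + y' \<and> w = x' - y'"
  then obtain x' y' where *: "x' \<in> Vp" "y' \<in> Vm" "x + y = x' + y'" "w = x' - y'" by blast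
  have "x - x' \<in> Vp" "y' - y \<in> Vm"
    using assms * subspace_Vp subspace_Vm by (auto intro: subspace_diff)
  moreover have eq: "x - x' = y' - y" using *(3) by (simp add: algebra_simps)
  ultimately have "ip (x - x') (x - x') = 0" using orthogonal by metis
  then have "x - x' = 0" by (simp add: ip_self)
  then show "w = x - y" using *(4) eq by simp
qed (use assms in blast)

definition B :: "'v \<Rightarrow> 'v \<Rightarrow> 'k" where
  "B x y = ip (grading x) y"

definition isotropic_subspace :: "'v set \<Rightarrow> bool" where
  "isotropic_subspace L \<longleftrightarrow> module.subspace scale L \<and> (\<forall>x\<in>L. \<forall>y\<in>L. B x y = 0)"

definition grading_sum :: "'v set \<Rightarrow> 'v set" where
  "grading_sum L = {x + grading y | x y. x \<in> L \<and> y \<in> L}"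

definition sub_lagrangian :: "'v set \<Rightarrow> bool" where
  "sub_lagrangian L \<longleftrightarrow> isotropic_subspace L \<and> finite_codim_in (grading_sum L) UNIV"

definition lagrangian :: "'v set \<Rightarrow> bool" where
  "lagrangian L \<longleftrightarrow> isotropic_subspace L \<and> grading_sum L = UNIV"

definition graph :: "('v \<Rightarrow> 'v) \<Rightarrow> 'v set" where
  "graph A = {x + A x | x. x \<in> Vp}"

definition graph' :: "('v \<Rightarrow> 'v) \<Rightarrow> 'v set" where
  "graph' A = graph A \<inter> orth_compl (ker Vp A)"

end

end

theory Submission
  imports Defs
begin

text \<open>
  Write \<open>P\<close> for the orthogonal projection onto a closed isotropic subspace \<open>L\<close> and \<open>v\<^sup>+, v\<^sup>-\<close> for
  the components of \<open>v\<close>. Isotropy means that \<open>\<Gamma> L\<close> is orthogonal to \<open>L\<close>, equivalently that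
  \<open>v\<^sup>+ \<mapsto> v\<^sup>-\<close> preserves inner products on \<open>L\<close>. Since \<open>v\<^sup>+ = (v + \<Gamma> v) / 2\<close>, this gives
  \<open>P v\<^sup>+ = v / 2\<close> for \<open>v\<close> in \<open>L\<close>, so the only possible partial isometry is
  \<open>u x = 2 (P x)\<^sup>-\<close>; its kernel is \<open>V\<^sup>+ \<inter> L\<^sup>\<bottom>\<close>. For the last part, \<open>L + \<Gamma> L\<close> is the orthogonal
  sum of \<open>V\<^sup>+ \<inter> (ker u)\<^sup>\<bottom>\<close> and the range of \<open>u\<close>, so its codimension is that of the range
  plus the dimension of the kernel.
\<close>

section \<open>Inner product identities, Cauchy-Schwarz and polarisation\<close>

context hilbert_space
begin

lemma ip_zero_left [simp]: "ip 0 y = 0"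
  using ip_add_left[of 0 0 y] by simp

lemma ip_minus_left: "ip (- x) y = - ip x y"
  using ip_add_left[of x "- x" y] by (simp add: minus_unique)

lemma ip_diff_left: "ip (x - y) z = ip x z - ip y z"
  using ip_add_left[of x "- y" z] ip_minus_left by simp

lemma ip_add_right: "ip x (y + z) = ip x y + ip x z"
  using ip_add_left[of y z x] conj_add ip_conj_sym by metis

lemma ip_zero_right [simp]: "ip x 0 = 0"
  using ip_add_right[of x 0 0] by simp

lemma ip_minus_right: "ip x (- y) = - ip x y"
  using ip_add_right[of x y "- y"] by (simp add: minus_unique)

lemma ip_diff_right: "ip x (y - z) = ip x y - ip x z"
  using ip_add_right[of x y "- z"] ip_minus_right by simp

lemma ip_scale_right: "ip x (scale c y) = conj c * ip x y"
  using ip_scale_left[of c y x] conj_mult ip_conj_sym by metis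

lemma ip_scaleR_left: "ip (r *\<^sub>R x) y = r *\<^sub>R ip x y"
  using ip_scale_left[of "of_real r" x y] by (simp add: scale_of_real scaleR_conv_of_real)

lemma ip_eq_zero_commute: "ip x y = 0 \<longleftrightarrow> ip y x = 0"
  by (metis ip_conj_sym ip_zero_left ip_zero_right)

lemma ip_self_eq_zero_iff [simp]: "ip x x = 0 \<longleftrightarrow> x = 0"
  by (simp add: ip_self)

lemma scale_scaleR_commute: "scale c (r *\<^sub>R x) = r *\<^sub>R scale c x"
  by (metis scale_of_real scale_left_commute)

lemma norm_add_sq_orthogonal:
  assumes "ip x y = 0"
  shows "(norm (x + y))\<^sup>2 = (norm x)\<^sup>2 + (norm y)\<^sup>2"
proof -
  have "ip (x + y) (x + y) = ip x x + ip y y"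
    using assms ip_eq_zero_commute[of x y] by (simp add: ip_add_left ip_add_right)
  then have "(of_real ((norm (x + y))\<^sup>2) :: 'k) = of_real ((norm x)\<^sup>2 + (norm y)\<^sup>2)"
    by (simp add: ip_self)
  then show ?thesis by (simp only: of_real_eq_iff)
qed

lemma parallelogram: "(norm (x + y))\<^sup>2 + (norm (x - y))\<^sup>2 = 2 * (norm x)\<^sup>2 + 2 * (norm y)\<^sup>2"
  for x y :: 'v
proof -
  have "ip (x + y) (x + y) + ip (x - y) (x - y) = 2 * ip x x + 2 * ip y y"
    by (simp add: ip_add_left ip_add_right ip_diff_left ip_diff_right)
  then have "(of_real ((norm (x + y))\<^sup>2 + (norm (x - y))\<^sup>2) :: 'k)
      = of_real (2 * (norm x)\<^sup>2 + 2 * (norm y)\<^sup>2)"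
    by (simp add: ip_self)
  then show ?thesis by (simp only: of_real_eq_iff)
qed

text \<open>The norm of the class is homogeneous for real scalars only; homogeneity over
  \<open>'k\<close> has to come from the inner product.\<close>

lemma norm_scale: "norm (scale c x) = norm c * norm x"
proof -
  have "ip (scale c x) (scale c x) = (c * conj c) * ip x x"
    by (simp add: ip_scale_left ip_scale_right)
  then have "(of_real ((norm (scale c x))\<^sup>2) :: 'k) = of_real ((norm c * norm x)\<^sup>2)"
    by (simp add: ip_self mult_conj power_mult_distrib)
  then have "(norm (scale c x))\<^sup>2 = (norm c * norm x)\<^sup>2"
    by (simp only: of_real_eq_iff)
  then show ?thesis by simp
qed

text \<open>The component \<open>scale c y\<close> of \<open>x\<close> along \<open>y\<close> is no
  longer than \<open>x\<close> by Pythagoras, and its length is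
  \<open>norm (ip x y) / norm y\<close>.\<close>

lemma Cauchy_Schwarz: "norm (ip x y) \<le> norm x * norm y"
proof (cases "y = 0")
  case False
  define c where "c = ip x y / ip y y"
  have "ip (x - scale c y) y = 0"
    using False by (simp add: c_def ip_diff_left ip_scale_left)
  then have "ip (x - scale c y) (scale c y) = 0"
    by (simp add: ip_scale_right)
  from norm_add_sq_orthogonal[OF this]
  have "(norm (scale c y))\<^sup>2 \<le> (norm x)\<^sup>2" by simp
  then have "norm (scale c y) \<le> norm x" by (simp add: abs_le_square_iff[symmetric])
  moreover have "norm (ip y y) = norm y * norm y"
    by (simp only: ip_self norm_of_real) (simp add: power2_eq_square)
  then have "norm (scale c y) = norm (ip x y) / norm y"
    using False by (simp add: norm_scale c_def norm_divide)
  ultimately show ?thesis using False by (simp add: field_simps)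
qed simp

lemma bounded_linear_ip_left: "bounded_linear (\<lambda>x. ip x y)"
  by (rule bounded_linear_intro[where K = "norm y"])
    (simp_all add: ip_add_left ip_scaleR_left Cauchy_Schwarz)

lemma closed_orth_compl: "closed (orth_compl S)"
proof -
  have "closed {x. ip x y = 0}" for y
    by (intro closed_Collect_eq bounded_linear.continuous_on[OF bounded_linear_ip_left]
        continuous_on_const continuous_on_id)
  moreover have "orth_compl S = (\<Inter>y\<in>S. {x. ip x y = 0})" by (auto simp: orth_compl_def)
  ultimately show ?thesis by auto
qed

lemma subspace_orth_compl: "subspace (orth_compl S)"
  by (rule subspaceI) (auto simp: orth_compl_def ip_add_left ip_scale_left)

lemma subspace_scaleR: "subspace W \<Longrightarrow> x \<in> W \<Longrightarrow> r *\<^sub>R x \<in> W"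
  by (metis scale_of_real subspace_scale)

text \<open>A form of polarisation that treats real and complex scalars alike. The defect
  \<open>d\<close> vanishes on the diagonal, so biadditivity makes it antisymmetric, while
  conjugation exchanges its arguments. A value of \<open>d\<close> that is fixed by conjugation
  therefore equals its own negative.\<close>

lemma norm_eq_imp_ip_eq:
  assumes W: "subspace W"
    and add: "\<And>x y. x \<in> W \<Longrightarrow> y \<in> W \<Longrightarrow> f (x + y) = f x + f y"
    and scale: "\<And>c x. x \<in> W \<Longrightarrow> f (scale c x) = scale c (f x)"
    and norm: "\<And>x. x \<in> W \<Longrightarrow> norm (f x) = norm x"
    and x: "x \<in> W" and y: "y \<in> W"
  shows "ip (f x) (f y) = ip x y"
proof -
  define d where "d x y = ip (f x) (f y) - ip x y" for x y
  have d_self: "d x x = 0" if "x \<in> W" for x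
    using norm[OF that] by (simp add: d_def ip_self)
  have anti: "d y x = - d x y" if "x \<in> W" "y \<in> W" for x y
  proof -
    have "d (x + y) (x + y) = d x x + d y y + (d x y + d y x)"
      using that by (simp add: d_def add ip_add_left ip_add_right)
    then have "d x y + d y x = 0"
      using d_self that subspace_add[OF W that] by simp
    then show ?thesis by (simp add: eq_neg_iff_add_eq_0 add.commute)
  qed
  have sym: "conj (d x y) = d y x" for x y
  proof -
    have "conj (d x y) + conj (ip x y) = conj (ip (f x) (f y))"
      unfolding conj_add[symmetric] by (simp add: d_def)
    then show ?thesis by (simp add: d_def ip_conj_sym[symmetric] eq_diff_eq)
  qed
  \<comment> \<open>Rescaling \<open>x\<close> makes the antisymmetric value \<open>d x y\<close> invariant under conjugation.\<close>
  let ?c = "conj (d x y)"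
  have cx: "scale ?c x \<in> W" using subspace_scale[OF W x] .
  have e: "d (scale ?c x) y = ?c * d x y"
    using x by (simp add: d_def scale ip_scale_left algebra_simps)
  have "conj (?c * d x y) = ?c * d x y"
    by (simp add: conj_mult conj_conj mult.commute)
  then have "?c * d x y = - (?c * d x y)"
    using anti[OF cx y] sym[of "scale ?c x" y] e by simp
  then have "?c * d x y = 0"
    by (metis add.right_inverse mult_2 mult_eq_0_iff zero_neq_numeral)
  then have "d x y = 0" by (metis mult_conj mult.commute norm_eq_zero of_real_eq_0_iff power_eq_0_iff)
  then show ?thesis by (simp add: d_def)
qed

section \<open>Orthogonal projection onto a closed subspace\<close>

lemma orthogonal_decomposition:
  assumes W: "subspace W" and cl: "closed W"
  shows "\<exists>w\<in>W. x - w \<in> orth_compl W"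
proof -
  \<comment> \<open>The required point is the one of \<open>W\<close> nearest to \<open>x\<close>: a
    minimising sequence is shown to be Cauchy, and its limit realises the distance
    \<open>d\<close>.\<close>
  define d where "d = Inf ((\<lambda>w. norm (x - w)) ` W)"
  have W0: "0 \<in> W" using W subspace_0 by blast
  have bdd: "bdd_below ((\<lambda>w. norm (x - w)) ` W)" by (rule bdd_belowI[of _ 0]) auto
  have d_le: "d \<le> norm (x - w)" if "w \<in> W" for w
    unfolding d_def using bdd that by (intro cInf_lower) auto
  have d0: "0 \<le> d" unfolding d_def using W0 by (intro cInf_greatest) auto
  have "\<exists>w\<in>W. norm (x - w) < d + 1 / Suc n" for n
  proof -
    have "\<exists>t\<in>(\<lambda>w. norm (x - w)) ` W. t < d + 1 / Suc n"
      using W0 bdd by (subst cInf_less_iff[symmetric]) (auto simp: d_def)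
    then show ?thesis by blast
  qed
  then obtain s where s: "\<And>n. s n \<in> W" "\<And>n. norm (x - s n) < d + 1 / Suc n" by metis
  \<comment> \<open>\<open>e n\<close> bounds the excess of the squared distance over
    \<open>d\<^sup>2\<close>; the quadratic error term is absorbed by bounding the square of
    \<open>1 / Suc n\<close> by \<open>1 / Suc n\<close>.\<close>
  define e where "e n = (2 * d + 1) / Suc n" for n
  have sq: "(norm (x - s n))\<^sup>2 \<le> d\<^sup>2 + e n" for n
  proof -
    have "(norm (x - s n))\<^sup>2 \<le> (d + 1 / Suc n)\<^sup>2"
      using s(2)[of n] by (intro power_mono) auto
    also have "\<dots> = d\<^sup>2 + 2 * d / Suc n + (1 / Suc n) * (1 / Suc n)"
      by (simp add: power2_eq_square algebra_simps)
    also have "(1 / Suc n) * (1 / Suc n) \<le> 1 / real (Suc n)"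
      by (intro mult_left_le) auto
    finally show ?thesis by (simp add: e_def add_divide_distrib)
  qed
  \<comment> \<open>The midpoint of \<open>s m\<close> and \<open>s n\<close> lies in
    \<open>W\<close>, so it is at distance at least \<open>d\<close> from \<open>x\<close>; the
    parallelogram law then leaves little room for \<open>s m - s n\<close>.\<close>
  have diff: "(norm (s m - s n))\<^sup>2 \<le> 2 * e m + 2 * e n" for m n
  proof -
    let ?h = "(1/2) *\<^sub>R (s m + s n)"
    have "?h \<in> W" using s(1) W by (intro subspace_scaleR subspace_add)
    then have "d\<^sup>2 \<le> (norm (x - ?h))\<^sup>2" using d_le d0 by (intro power_mono) auto
    moreover have "(x - s m) + (x - s n) = 2 *\<^sub>R (x - ?h)"
      by (simp add: algebra_simps scaleR_2)
    then have "(norm ((x - s m) + (x - s n)))\<^sup>2 = 4 * (norm (x - ?h))\<^sup>2"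
      by (simp add: power_mult_distrib)
    moreover have "norm ((x - s m) - (x - s n)) = norm (s m - s n)"
      by (simp add: norm_minus_commute)
    ultimately show ?thesis
      using parallelogram[of "x - s m" "x - s n"] sq[of m] sq[of n] by simp
  qed
  have e_lim: "e \<longlonglongrightarrow> 0"
    unfolding e_def using LIMSEQ_Suc[OF lim_const_over_n[of "2 * d + 1"]] by simp
  have "Cauchy s"
  proof (rule CauchyI)
    fix r :: real assume r: "0 < r"
    then have "eventually (\<lambda>n. e n < r\<^sup>2 / 4) sequentially"
      using e_lim by (intro order_tendstoD(2)[of _ 0]) auto
    then obtain N where N: "\<And>n. n \<ge> N \<Longrightarrow> e n < r\<^sup>2 / 4"
      by (auto simp: eventually_sequentially)
    have "norm (s m - s n) < r" if "m \<ge> N" "n \<ge> N" for m n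
    proof (rule power_less_imp_less_base[where n = 2])
      show "(norm (s m - s n))\<^sup>2 < r\<^sup>2"
        using diff[of m n] N[OF that(1)] N[OF that(2)] by simp
    qed (use r in simp)
    then show "\<exists>M. \<forall>m\<ge>M. \<forall>n\<ge>M. norm (s m - s n) < r" by blast
  qed
  then obtain w where w: "s \<longlonglongrightarrow> w" using Cauchy_convergent convergent_def by blast
  have wW: "w \<in> W" using closed_sequentially[OF cl] s(1) w by blast
  have "(\<lambda>n. d + 1 / Suc n) \<longlonglongrightarrow> d + 0"
    using LIMSEQ_Suc[OF lim_const_over_n[of "1::real"]] by (intro tendsto_add tendsto_const) simp
  moreover have "(\<lambda>n. norm (x - s n)) \<longlonglongrightarrow> norm (x - w)" by (intro tendsto_intros w)
  ultimately have w_le: "norm (x - w) \<le> d"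
    using LIMSEQ_le[of "\<lambda>n. norm (x - s n)" _ "\<lambda>n. d + 1 / Suc n" d] s(2)
    by (auto intro: less_imp_le)
  \<comment> \<open>Otherwise moving \<open>w\<close> by the component of \<open>x - w\<close> along
    \<open>y\<close> would stay in \<open>W\<close> and come strictly closer to
    \<open>x\<close>.\<close>
  have "ip (x - w) y = 0" if y: "y \<in> W" for y
  proof (cases "y = 0")
    case False
    define c where "c = ip (x - w) y / ip y y"
    let ?t = "x - w - scale c y"
    have "ip ?t (scale c y) = 0"
      using False by (simp add: c_def ip_diff_left ip_scale_left ip_scale_right)
    from norm_add_sq_orthogonal[OF this]
    have "(norm (x - w))\<^sup>2 = (norm ?t)\<^sup>2 + (norm (scale c y))\<^sup>2" by simp
    moreover have "w + scale c y \<in> W"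
      using W wW y by (intro subspace_add subspace_scale)
    then have "norm (x - w) \<le> norm ?t"
      using d_le w_le by (fastforce simp: diff_diff_eq)
    then have "(norm (x - w))\<^sup>2 \<le> (norm ?t)\<^sup>2" by (intro power_mono) auto
    ultimately have "(norm (scale c y))\<^sup>2 \<le> 0" by linarith
    then have "scale c y = 0" by simp
    then show ?thesis using False by (simp add: c_def)
  qed simp
  then show ?thesis using wW by (auto simp: orth_compl_def)
qed

definition proj :: "'v set \<Rightarrow> 'v \<Rightarrow> 'v" where
  "proj W x = (THE w. w \<in> W \<and> x - w \<in> orth_compl W)"

text \<open>Two candidates differ by a vector that is orthogonal to itself. This is the rule by
  which projections are computed below.\<close>

lemma proj_eqI:
  assumes "subspace W" "w \<in> W" "x - w \<in> orth_compl W"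
  shows "proj W x = w"
  unfolding proj_def
proof (rule the_equality)
  fix w' assume *: "w' \<in> W \<and> x - w' \<in> orth_compl W"
  have "(x - w') - (x - w) \<in> orth_compl W"
    using * assms(3) by (blast intro: subspace_diff[OF subspace_orth_compl])
  then have "w - w' \<in> orth_compl W" by simp
  moreover have "w - w' \<in> W" using * assms by (intro subspace_diff) auto
  ultimately have "ip (w - w') (w - w') = 0" by (auto simp: orth_compl_def)
  then show "w' = w" by simp
qed (use assms in blast)

context
  fixes W assumes W: "subspace W" "closed W"
begin

lemma proj_in: "proj W x \<in> W"
  and proj_orth: "x - proj W x \<in> orth_compl W"
  using orthogonal_decomposition[OF W, of x] proj_eqI[OF W(1)] by auto

lemma proj_add: "proj W (x + y) = proj W x + proj W y"
proof (rule proj_eqI[OF W(1)])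
  have "(x - proj W x) + (y - proj W y) \<in> orth_compl W"
    by (intro subspace_add subspace_orth_compl proj_orth)
  then show "x + y - (proj W x + proj W y) \<in> orth_compl W" by (simp add: algebra_simps)
qed (intro subspace_add W proj_in)

lemma proj_scale: "proj W (scale c x) = scale c (proj W x)"
proof (rule proj_eqI[OF W(1)])
  have "scale c (x - proj W x) \<in> orth_compl W"
    by (intro subspace_scale subspace_orth_compl proj_orth)
  then show "scale c x - scale c (proj W x) \<in> orth_compl W" by (simp add: scale_right_diff_distrib)
qed (intro subspace_scale W proj_in)

lemma norm_proj_le: "norm (proj W x) \<le> norm x"
proof -
  have "ip (x - proj W x) (proj W x) = 0"
    using proj_orth proj_in by (auto simp: orth_compl_def)
  from norm_add_sq_orthogonal[OF this]
  have "(norm (proj W x))\<^sup>2 \<le> (norm x)\<^sup>2" by simp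
  then show ?thesis by (simp add: abs_le_square_iff[symmetric])
qed

end

lemma proj_ident: "subspace W \<Longrightarrow> x \<in> W \<Longrightarrow> proj W x = x"
  by (rule proj_eqI) (auto simp: orth_compl_def)

lemma proj_orth_eq_0: "subspace W \<Longrightarrow> x \<in> orth_compl W \<Longrightarrow> proj W x = 0"
  by (rule proj_eqI) (auto intro: subspace_0)

text \<open>Serves to push a finite set that spans a complement through \<open>proj\<close> and
  \<open>pm\<close> when codimensions are compared.\<close>

lemma span_image_additive:
  assumes "\<And>x y. f (x + y) = f x + f y" "\<And>c x. f (scale c x) = scale c (f x)"
  shows "span (f ` S) = f ` span S"
proof -
  interpret f: module_hom scale scale f
    by unfold_locales (use assms in auto)
  show ?thesis by (rule f.span_image)
qed

end

section \<open>Components with respect to the grading\<close>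

context super_hilbert_space
begin

text \<open>\<open>pp\<close> and \<open>pm\<close> are the orthogonal projections onto
  \<open>Vp\<close> and \<open>Vm\<close>, written through the grading so that relations such as
  \<open>pp v - v/2 = grading v / 2\<close> are immediate.\<close>

definition pp :: "'v \<Rightarrow> 'v" where "pp v = (1/2) *\<^sub>R (v + grading v)"
definition pm :: "'v \<Rightarrow> 'v" where "pm v = (1/2) *\<^sub>R (v - grading v)"

lemma pp_add_eq: "x \<in> Vp \<Longrightarrow> y \<in> Vm \<Longrightarrow> pp (x + y) = x"
  and pm_add_eq: "x \<in> Vp \<Longrightarrow> y \<in> Vm \<Longrightarrow> pm (x + y) = y"
  by (simp_all add: pp_def pm_def grading_add algebra_simps flip: scaleR_2)

lemma pp_plus_pm: "pp v + pm v = v"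
  by (simp add: pp_def pm_def flip: scaleR_right_distrib scaleR_2)

lemma grading_eq: "grading v = pp v - pm v"
  by (simp add: pp_def pm_def flip: scaleR_right_diff_distrib scaleR_2)

lemma pp_in: "pp v \<in> Vp" and pm_in: "pm v \<in> Vm"
  using decomposition[of v] pp_add_eq pm_add_eq by auto

lemma zero_in_Vp: "0 \<in> Vp" and zero_in_Vm: "0 \<in> Vm"
  using subspace_Vp subspace_Vm subspace_0 by auto

lemma pp_Vp: "x \<in> Vp \<Longrightarrow> pp x = x" and pm_Vp: "x \<in> Vp \<Longrightarrow> pm x = 0"
  using pp_add_eq[of x 0] pm_add_eq[of x 0] zero_in_Vm by auto

lemma pm_Vm: "y \<in> Vm \<Longrightarrow> pm y = y"
  using pm_add_eq[of 0 y] zero_in_Vp by auto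

lemma pp_add: "pp (x + y) = pp x + pp y" and pm_add: "pm (x + y) = pm x + pm y"
proof -
  have e: "x + y = (pp x + pp y) + (pm x + pm y)"
    using pp_plus_pm[of x] pp_plus_pm[of y] by (simp add: algebra_simps)
  have "pp x + pp y \<in> Vp" "pm x + pm y \<in> Vm"
    using subspace_Vp subspace_Vm pp_in pm_in by (auto intro: subspace_add)
  then show "pp (x + y) = pp x + pp y" "pm (x + y) = pm x + pm y"
    unfolding e by (rule pp_add_eq pm_add_eq)+
qed

lemma pp_scale: "pp (scale c x) = scale c (pp x)" and pm_scale: "pm (scale c x) = scale c (pm x)"
proof -
  have e: "scale c x = scale c (pp x) + scale c (pm x)"
    using pp_plus_pm[of x] by (simp flip: scale_right_distrib)
  have "scale c (pp x) \<in> Vp" "scale c (pm x) \<in> Vm"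
    using subspace_Vp subspace_Vm pp_in pm_in by (auto intro: subspace_scale)
  then show "pp (scale c x) = scale c (pp x)" "pm (scale c x) = scale c (pm x)"
    unfolding e by (rule pp_add_eq pm_add_eq)+
qed

lemma pp_scaleR: "pp (r *\<^sub>R x) = r *\<^sub>R pp x" and pm_scaleR: "pm (r *\<^sub>R x) = r *\<^sub>R pm x"
  using pp_scale pm_scale by (simp_all flip: scale_of_real)

lemma orthogonal': "x \<in> Vp \<Longrightarrow> y \<in> Vm \<Longrightarrow> ip y x = 0"
  using orthogonal ip_eq_zero_commute by blast

lemma ip_pp_pm: "ip x y = ip (pp x) (pp y) + ip (pm x) (pm y)"
proof -
  have "ip x y = ip (pp x + pm x) (pp y + pm y)" by (simp add: pp_plus_pm)
  also have "\<dots> = ip (pp x) (pp y) + ip (pm x) (pm y)"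
    using orthogonal[OF pp_in pm_in] orthogonal'[OF pp_in pm_in]
    by (simp add: ip_add_left ip_add_right)
  finally show ?thesis .
qed

lemma ip_Vp_left: "x \<in> Vp \<Longrightarrow> ip x y = ip x (pp y)"
  using ip_pp_pm[of x y] by (simp add: pp_Vp pm_Vp)

lemma ip_Vp_right: "x \<in> Vp \<Longrightarrow> ip y x = ip (pp y) x"
  using ip_pp_pm[of y x] by (simp add: pp_Vp pm_Vp)

text \<open>\<open>grading\<close> only flips the sign of the \<open>Vm\<close> component. Isotropy
  thus becomes equality of the inner products of the two components.\<close>

lemma B_eq: "B x y = ip (pp x) (pp y) - ip (pm x) (pm y)"
proof -
  have "pp (pp x - pm x) = pp x" "pm (pp x - pm x) = - pm x"
    using pp_add_eq[of "pp x" "- pm x"] pm_add_eq[of "pp x" "- pm x"] pp_in pm_in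
      subspace_neg[OF subspace_Vm] by auto
  then show ?thesis
    using ip_pp_pm[of "pp x - pm x" y] by (simp add: B_def grading_eq ip_minus_left)
qed

lemma norm_pp_pm: "(norm v)\<^sup>2 = (norm (pp v))\<^sup>2 + (norm (pm v))\<^sup>2"
  using norm_add_sq_orthogonal[OF orthogonal[OF pp_in pm_in], of v v] by (simp add: pp_plus_pm)

lemma norm_pp_le: "norm (pp v) \<le> norm v" and norm_pm_le: "norm (pm v) \<le> norm v"
  by (rule power2_le_imp_le; simp add: norm_pp_pm[of v])+

lemma bounded_linear_pm: "bounded_linear pm"
  by (rule bounded_linear_intro[where K = 1]) (simp_all add: pm_add pm_scaleR norm_pm_le)

section \<open>Bounded operators: kernel, graph and \<open>grading_sum\<close>\<close>

context
  fixes u assumes u: "bounded_operator Vp Vm u"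
begin

lemma operator_add: "x \<in> Vp \<Longrightarrow> y \<in> Vp \<Longrightarrow> u (x + y) = u x + u y"
  and operator_scale: "x \<in> Vp \<Longrightarrow> u (scale c x) = scale c (u x)"
  and operator_in: "x \<in> Vp \<Longrightarrow> u x \<in> Vm"
  using u by (auto simp: bounded_operator_def)

lemma operator_scaleR: "x \<in> Vp \<Longrightarrow> u (r *\<^sub>R x) = r *\<^sub>R u x"
  by (metis operator_scale scale_of_real)

lemma operator_zero: "u 0 = 0"
  using operator_scale[of 0 0] zero_in_Vp by simp

text \<open>Precomposing with \<open>pp\<close> turns \<open>u\<close>, which is
  \<open>undefined\<close> off \<open>Vp\<close>, into a continuous map on the whole type, so kernel
  and graph become solution sets of continuous equations. The absolute value covers a negative
  \<open>K\<close>, possible when \<open>Vp\<close> is trivial.\<close>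

lemma bounded_linear_operator_pp: "bounded_linear (\<lambda>v. u (pp v))"
proof -
  obtain K where K: "\<forall>x\<in>Vp. norm (u x) \<le> K * norm x"
    using u by (auto simp: bounded_operator_def)
  have "norm (u (pp x)) \<le> norm x * \<bar>K\<bar>" for x
  proof -
    have "norm (u (pp x)) \<le> K * norm (pp x)" using K pp_in by blast
    also have "\<dots> \<le> \<bar>K\<bar> * norm x"
      by (intro mult_mono norm_pp_le) auto
    finally show ?thesis by (simp add: mult.commute)
  qed
  then show ?thesis
    by (intro bounded_linear_intro[where K = "\<bar>K\<bar>"])
      (simp_all add: pp_add pp_scaleR operator_add operator_scaleR pp_in)
qed

lemma subspace_ker: "subspace (ker Vp u)"
  using subspace_Vp
  by (intro subspaceI)
    (auto simp: ker_def operator_add operator_scale operator_zero intro: subspace_0 subspace_add subspace_scale)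

lemma closed_ker: "closed (ker Vp u)"
proof -
  have "ker Vp u = {v. pm v = 0} \<inter> {v. u (pp v) = 0}"
  proof (intro set_eqI iffI)
    fix v assume "v \<in> {v. pm v = 0} \<inter> {v. u (pp v) = 0}"
    then show "v \<in> ker Vp u" using pp_plus_pm[of v] pp_in[of v] by (auto simp: ker_def)
  qed (auto simp: ker_def pp_Vp pm_Vp)
  moreover have "closed {v. pm v = 0}" "closed {v. u (pp v) = 0}"
    by (intro closed_Collect_eq continuous_on_const continuous_on_id
        bounded_linear.continuous_on[OF bounded_linear_pm]
        bounded_linear.continuous_on[OF bounded_linear_operator_pp])+
  ultimately show ?thesis by (metis closed_Int)
qed

lemma closed_graph: "closed (graph u)"
proof -
  have "graph u = {v. pm v = u (pp v)}"
  proof (intro set_eqI iffI)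
    fix v assume "v \<in> {v. pm v = u (pp v)}"
    then show "v \<in> graph u" using pp_plus_pm[of v] pp_in[of v] unfolding graph_def by force
  qed (auto simp: graph_def pp_add_eq pm_add_eq operator_in)
  moreover have "closed {v. pm v = u (pp v)}"
    by (intro closed_Collect_eq continuous_on_id
        bounded_linear.continuous_on[OF bounded_linear_pm]
        bounded_linear.continuous_on[OF bounded_linear_operator_pp])
  ultimately show ?thesis by simp
qed

text \<open>Project \<open>x\<close> onto the closed kernel; the remainder stays in
  \<open>Vp\<close> because the kernel lies there. Hence every value of \<open>u\<close> is already
  taken on the complement of the kernel.\<close>

lemma ker_decomposition:
  assumes "x \<in> Vp"
  obtains n m where "x = n + m" "n \<in> ker Vp u" "m \<in> Vp \<inter> orth_compl (ker Vp u)" "u m = u x"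
proof -
  obtain n where n: "n \<in> ker Vp u" "x - n \<in> orth_compl (ker Vp u)"
    using orthogonal_decomposition[OF subspace_ker closed_ker] by blast
  have "x - n \<in> Vp" using assms n(1) subspace_Vp by (auto simp: ker_def intro: subspace_diff)
  moreover from this have "u (n + (x - n)) = u (x - n)"
    using n(1) by (subst operator_add) (auto simp: ker_def)
  ultimately show ?thesis using n by (intro that[of n "x - n"]) auto
qed

text \<open>The kernel lies in \<open>Vp\<close> and \<open>u x\<close> in \<open>Vm\<close>, so
  orthogonality of \<open>x + u x\<close> to the kernel depends on \<open>x\<close> alone.\<close>

lemma graph'_eq: "graph' u = (\<lambda>x. x + u x) ` (Vp \<inter> orth_compl (ker Vp u))"
proof -
  have "ip (x + u x) n = ip x n" if "x \<in> Vp" "n \<in> ker Vp u" for x n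
    using that ip_Vp_right[of n "x + u x"] by (auto simp: ker_def pp_add_eq operator_in)
  then show ?thesis by (auto simp: graph'_def graph_def orth_compl_def)
qed

lemma subspace_graph': "subspace (graph' u)"
proof -
  have M: "subspace (Vp \<inter> orth_compl (ker Vp u))"
    by (intro subspace_inter subspace_Vp subspace_orth_compl)
  show ?thesis
  proof (rule subspaceI)
    show "0 \<in> graph' u" unfolding graph'_eq
      using subspace_0[OF M] operator_zero by (intro image_eqI[of _ _ 0]) auto
    fix v w c assume "v \<in> graph' u"
    then obtain x where x: "x \<in> Vp \<inter> orth_compl (ker Vp u)" "v = x + u x"
      by (auto simp: graph'_eq)
    show "scale c v \<in> graph' u" unfolding graph'_eq x(2)
      using x subspace_scale[OF M x(1), of c]
      by (intro image_eqI[of _ _ "scale c x"]) (auto simp: scale_right_distrib operator_scale)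
    assume "w \<in> graph' u"
    then obtain y where y: "y \<in> Vp \<inter> orth_compl (ker Vp u)" "w = y + u y"
      by (auto simp: graph'_eq)
    show "v + w \<in> graph' u" unfolding graph'_eq x(2) y(2)
      using x y subspace_add[OF M x(1) y(1)]
      by (intro image_eqI[of _ _ "x + y"]) (auto simp: algebra_simps operator_add)
  qed
qed

text \<open>A typical element \<open>(x + u x) + grading (y + u y)\<close> equals
  \<open>(x + y) + u (x - y)\<close>, and \<open>x + y\<close> and \<open>x - y\<close> can be
  prescribed independently in the complement of the kernel.\<close>

lemma grading_sum_graph':
  "grading_sum (graph' u) = {x + y |x y. x \<in> Vp \<inter> orth_compl (ker Vp u) \<and> y \<in> u ` Vp}"
proof -
  let ?M = "Vp \<inter> orth_compl (ker Vp u)"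
  have M: "subspace ?M"
    by (intro subspace_inter subspace_Vp subspace_orth_compl)
  show ?thesis
  proof (intro set_eqI iffI)
    fix v assume "v \<in> grading_sum (graph' u)"
    then obtain x y where xy: "x \<in> ?M" "y \<in> ?M" "v = (x + u x) + grading (y + u y)"
      by (auto simp: grading_sum_def graph'_eq)
    have "v = (x + y) + (u x - u y)"
      using xy by (simp add: grading_add operator_in)
    moreover have "u x - u y = u (x - y)"
      using operator_add[of "x - y" y] xy subspace_diff[OF M xy(1,2)] by (simp add: eq_diff_eq)
    ultimately show "v \<in> {x + y |x y. x \<in> ?M \<and> y \<in> u ` Vp}"
      using subspace_add[OF M xy(1,2)] subspace_diff[OF M xy(1,2)] by blast
  next
    fix v assume "v \<in> {x + y |x y. x \<in> ?M \<and> y \<in> u ` Vp}"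
    then obtain x z where x: "x \<in> ?M" and z: "z \<in> Vp" and v: "v = x + u z" by blast
    obtain y where y: "y \<in> ?M" "u y = u z" using ker_decomposition[OF z] by metis
    \<comment> \<open>\<open>a\<close> and \<open>b\<close> solve \<open>a + b = x\<close> and
      \<open>a - b = y\<close>.\<close>
    define a b where "a = (1/2) *\<^sub>R (x + y)" and "b = (1/2) *\<^sub>R (x - y)"
    have ab: "a \<in> ?M" "b \<in> ?M"
      unfolding a_def b_def
      by (rule subspace_scaleR[OF M subspace_add[OF M x y(1)]]
          subspace_scaleR[OF M subspace_diff[OF M x y(1)]])+
    have "a + b = x" "a - b = y"
      by (simp_all add: a_def b_def algebra_simps flip: scaleR_2)
    moreover have "u a - u b = u (a - b)"
      using operator_add[of "a - b" b] ab subspace_diff[OF M ab] by (simp add: eq_diff_eq)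
    ultimately have "v = (a + u a) + grading (b + u b)"
      using ab v y by (simp add: grading_add operator_in algebra_simps)
    then show "v \<in> grading_sum (graph' u)"
      using ab by (auto simp: grading_sum_def graph'_eq)
  qed
qed

end

section \<open>Truncated graphs of partial isometries\<close>

context
  fixes u assumes u: "partial_isometry Vp Vm u"
begin

lemma partial_isometry_bounded: "bounded_operator Vp Vm u"
  using u by (simp add: partial_isometry_def)

lemma partial_isometry_ip:
  assumes "x \<in> Vp \<inter> orth_compl (ker Vp u)" "y \<in> Vp \<inter> orth_compl (ker Vp u)"
  shows "ip (u x) (u y) = ip x y"
proof (rule norm_eq_imp_ip_eq[OF _ _ _ _ assms])
  show "subspace (Vp \<inter> orth_compl (ker Vp u))"
    by (intro subspace_inter subspace_Vp subspace_orth_compl)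
qed (use u in \<open>auto simp: partial_isometry_def bounded_operator_def\<close>)

text \<open>By \<open>B_eq\<close>, the form on \<open>x + u x\<close> and \<open>y + u y\<close> is
  \<open>ip x y - ip (u x) (u y)\<close>, and \<open>u\<close> preserves inner products on the
  complement of its kernel.\<close>

lemma isotropic_graph': "isotropic_subspace (graph' u)"
  using partial_isometry_ip subspace_graph'[OF partial_isometry_bounded]
  by (auto simp: isotropic_subspace_def graph'_eq[OF partial_isometry_bounded] B_eq pp_add_eq pm_add_eq
      operator_in[OF partial_isometry_bounded])

lemma closed_graph': "closed (graph' u)"
  unfolding graph'_def
  by (intro closed_Int closed_graph partial_isometry_bounded closed_orth_compl)

text \<open>The right-hand side involves \<open>u\<close> only through \<open>graph' u\<close>,
  which yields uniqueness. The kernel part \<open>n\<close> of \<open>x\<close> is orthogonal to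
  \<open>graph' u\<close>, and the other part \<open>m\<close> projects to half of
  \<open>m + u m\<close>, since the remainder is half of \<open>grading (m + u m)\<close>.\<close>

lemma partial_isometry_eq_proj:
  assumes x: "x \<in> Vp"
  shows "u x = 2 *\<^sub>R pm (proj (graph' u) x)"
proof -
  note b = partial_isometry_bounded
  note L = subspace_graph'[OF b] closed_graph'
  obtain n m where nm: "x = n + m" "n \<in> ker Vp u" "m \<in> Vp \<inter> orth_compl (ker Vp u)" "u m = u x"
    using ker_decomposition[OF b x] by blast
  have "n \<in> orth_compl (graph' u)"
    using nm(2) ip_eq_zero_commute unfolding graph'_def orth_compl_def by blast
  then have n0: "proj (graph' u) n = 0" by (rule proj_orth_eq_0[OF L(1)])
  have "proj (graph' u) m = (1/2) *\<^sub>R (m + u m)"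
  proof (rule proj_eqI[OF L(1)])
    have um: "u m \<in> Vm" using nm(3) operator_in[OF b] by auto
    have mu: "m + u m \<in> graph' u" using nm(3) graph'_eq[OF b] by auto
    then show "(1/2) *\<^sub>R (m + u m) \<in> graph' u" using L by (intro subspace_scaleR)
    have "m - (1/2) *\<^sub>R (m + u m) = (1/2) *\<^sub>R (m - u m)"
      by (simp add: algebra_simps flip: scaleR_2)
    also have "\<dots> = (1/2) *\<^sub>R grading (m + u m)"
      using um nm(3) by (simp add: grading_add)
    also have "grading (m + u m) \<in> orth_compl (graph' u)"
      using isotropic_graph' mu by (auto simp: isotropic_subspace_def B_def orth_compl_def)
    then have "(1/2) *\<^sub>R grading (m + u m) \<in> orth_compl (graph' u)"
      by (intro subspace_scaleR subspace_orth_compl)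
    finally show "m - (1/2) *\<^sub>R (m + u m) \<in> orth_compl (graph' u)" .
  qed
  moreover have "proj (graph' u) x = proj (graph' u) n + proj (graph' u) m"
    using proj_add[OF L] nm by simp
  moreover have "pm (m + u m) = u m"
    using nm(3) by (intro pm_add_eq operator_in[OF b]) auto
  ultimately show ?thesis
    using nm(4) n0 by (simp add: pm_scaleR)
qed

text \<open>A finite set completing \<open>?S\<close> to the whole space is mapped by
  \<open>proj ?N\<close> to a spanning set of the kernel and by \<open>pm\<close> to one completing
  the range in \<open>Vm\<close>. Conversely, finite sets for kernel and range together complete
  \<open>?S\<close>.\<close>

lemma sub_lagrangian_graph'_iff: "sub_lagrangian (graph' u) \<longleftrightarrow> fredholm Vp Vm u"
proof -
  note b = partial_isometry_bounded
  let ?N = "ker Vp u" and ?M = "Vp \<inter> orth_compl (ker Vp u)"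
  let ?S = "grading_sum (graph' u)"
  note S = grading_sum_graph'[OF b]
  have M0: "0 \<in> ?M" using zero_in_Vp by (auto simp: orth_compl_def)
  have u0: "0 \<in> u ` Vp" using operator_zero[OF b] zero_in_Vp by (intro image_eqI[of _ _ 0]) auto
  have MS: "?M \<subseteq> ?S" unfolding S using u0 by force
  have US: "u ` Vp \<subseteq> ?S" unfolding S using M0 by force
  have "finite_codim_in ?S UNIV \<longleftrightarrow> finite_dim ?N \<and> finite_codim_in (u ` Vp) Vm"
  proof
    assume "finite_codim_in ?S UNIV"
    then obtain F where F: "finite F" "span (?S \<union> F) = UNIV" by (auto simp: finite_codim_in_def)
    note N = subspace_ker[OF b] closed_ker[OF b]
    \<comment> \<open>Both summands of \<open>?S\<close> are orthogonal to the kernel: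
      \<open>?M\<close> by construction, the range because it lies in \<open>Vm\<close>.\<close>
    have S0: "proj ?N ` ?S \<subseteq> {0}"
    proof clarify
      fix v assume "v \<in> ?S"
      then obtain x y where xy: "x \<in> ?M" "y \<in> Vp" "v = x + u y" unfolding S by blast
      have "x + u y \<in> orth_compl ?N"
        using xy orthogonal'[OF _ operator_in[OF b xy(2)]] by (auto simp: orth_compl_def ker_def ip_add_left)
      then show "proj ?N v = 0" using proj_orth_eq_0 N xy by simp
    qed
    have "?N = proj ?N ` UNIV"
    proof
      show "?N \<subseteq> range (proj ?N)" using proj_ident[OF N(1)] by (metis rangeI subsetI)
      show "range (proj ?N) \<subseteq> ?N" using proj_in[OF N] by blast
    qed
    also have "\<dots> = span (proj ?N ` (?S \<union> F))"
      unfolding F(2)[symmetric] by (rule span_image_additive[symmetric]) (simp_all add: proj_add N proj_scale)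
    also have "\<dots> = span (proj ?N ` F)"
    proof (rule antisym)
      have "proj ?N ` (?S \<union> F) \<subseteq> span (proj ?N ` F)"
        unfolding image_Un using S0 span_zero[of "proj ?N ` F"]
        by (intro Un_least order_trans[OF S0] span_superset) simp
      then show "span (proj ?N ` (?S \<union> F)) \<subseteq> span (proj ?N ` F)"
        by (rule span_minimal) (rule subspace_span)
    qed (intro span_mono, blast)
    finally have "finite_dim ?N" using F(1) by (auto simp: finite_dim_def)
    moreover have "finite_codim_in (u ` Vp) Vm"
    proof -
      have pmS: "pm ` ?S \<subseteq> u ` Vp"
        by (auto simp: S pm_add_eq operator_in[OF b])
      have uVm: "u ` Vp \<subseteq> Vm" using operator_in[OF b] by blast
      have "Vm = pm ` UNIV"
      proof
        show "Vm \<subseteq> range pm" using pm_Vm by (metis rangeI subsetI)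
        show "range pm \<subseteq> Vm" using pm_in by blast
      qed
      also have "\<dots> = span (pm ` (?S \<union> F))"
        unfolding F(2)[symmetric] by (rule span_image_additive[symmetric]) (simp_all add: pm_add pm_scale)
      also have "\<dots> \<subseteq> span (u ` Vp \<union> pm ` F)"
        using pmS by (intro span_mono) blast
      finally have "Vm \<subseteq> span (u ` Vp \<union> pm ` F)" .
      moreover have "span (u ` Vp \<union> pm ` F) \<subseteq> Vm"
        using uVm pm_in by (intro span_minimal subspace_Vm) auto
      ultimately show ?thesis
        using F(1) pm_in unfolding finite_codim_in_def by (intro exI[of _ "pm ` F"]) auto
    qed
    ultimately show "finite_dim ?N \<and> finite_codim_in (u ` Vp) Vm" ..
  next
    assume "finite_dim ?N \<and> finite_codim_in (u ` Vp) Vm"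
    then obtain F G where F: "finite F" "span F = ?N" and G: "finite G" "span (u ` Vp \<union> G) = Vm"
      by (auto simp: finite_dim_def finite_codim_in_def)
    let ?T = "span (?S \<union> (F \<union> G))"
    have "v \<in> ?T" for v
    proof -
      obtain n m where nm: "pp v = n + m" "n \<in> ?N" "m \<in> ?M"
        using ker_decomposition[OF b pp_in] by metis
      have "n \<in> ?T" using nm(2) F(2) span_mono[of F "?S \<union> (F \<union> G)"] by blast
      moreover have "m \<in> ?T" using nm(3) MS by (intro span_base) auto
      moreover have "pm v \<in> ?T"
        using pm_in[of v] G(2) US span_mono[of "u ` Vp \<union> G" "?S \<union> (F \<union> G)"] by blast
      ultimately have "n + m + pm v \<in> ?T" by (intro span_add)
      then show ?thesis using nm pp_plus_pm by metis
    qed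
    then show "finite_codim_in ?S UNIV"
      using F(1) G(1) unfolding finite_codim_in_def by (intro exI[of _ "F \<union> G"]) auto
  qed
  then show ?thesis
    using b isotropic_graph' by (simp add: sub_lagrangian_def fredholm_def)
qed

text \<open>If the sum is everything, taking components gives \<open>?M = Vp\<close>, so
  \<open>u\<close> is isometric on all of \<open>Vp\<close>, and surjectivity onto
  \<open>Vm\<close>. Conversely a unitary has trivial kernel, so again
  \<open>?M = Vp\<close>.\<close>

lemma lagrangian_graph'_iff: "lagrangian (graph' u) \<longleftrightarrow> unitary Vp Vm u"
proof -
  note b = partial_isometry_bounded
  let ?M = "Vp \<inter> orth_compl (ker Vp u)"
  note S = grading_sum_graph'[OF b]
  have "grading_sum (graph' u) = UNIV \<longleftrightarrow> unitary Vp Vm u"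
  proof
    assume *: "grading_sum (graph' u) = UNIV"
    have "x \<in> ?M" if x: "x \<in> Vp" for x
    proof -
      have "x \<in> grading_sum (graph' u)" using * by simp
      then obtain a y where ay: "x = a + u y" "a \<in> ?M" "y \<in> Vp" unfolding S by blast
      then have "pp x = a" by (simp add: pp_add_eq operator_in[OF b])
      then show ?thesis using x ay by (simp add: pp_Vp)
    qed
    moreover have "z \<in> u ` Vp" if z: "z \<in> Vm" for z
    proof -
      have "z \<in> grading_sum (graph' u)" using * by simp
      then obtain a y where ay: "z = a + u y" "a \<in> ?M" "y \<in> Vp" unfolding S by blast
      then have "pm z = u y" by (simp add: pm_add_eq operator_in[OF b])
      then show ?thesis using z ay by (simp add: pm_Vm)
    qed
    ultimately show "unitary Vp Vm u"
      using b partial_isometry_ip operator_in[OF b] unfolding unitary_def by blast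
  next
    assume *: "unitary Vp Vm u"
    have "ker Vp u \<subseteq> {0}"
    proof
      fix x assume x: "x \<in> ker Vp u"
      then have "ip (u x) (u x) = ip x x" using * unfolding unitary_def ker_def by blast
      then show "x \<in> {0}" using x by (simp add: ker_def)
    qed
    then have "?M = Vp" by (auto simp: orth_compl_def)
    then show "grading_sum (graph' u) = UNIV"
      unfolding S using * decomposition unfolding unitary_def by blast
  qed
  then show ?thesis using isotropic_graph' by (simp add: lagrangian_def)
qed

end

section \<open>Existence and uniqueness of the partial isometry\<close>

lemma isotropic_imp_graph':
  assumes cl: "closed L" and iso: "isotropic_subspace L"
  shows "\<exists>u. partial_isometry Vp Vm u \<and> L = graph' u"
proof -
  have L: "subspace L" using iso by (simp add: isotropic_subspace_def)
  note PL = L cl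
  have eq: "ip (pp v) (pp w) = ip (pm v) (pm w)" if "v \<in> L" "w \<in> L" for v w
    using iso that by (simp add: isotropic_subspace_def B_eq)
  have norm_eq: "norm (pp v) = norm (pm v)" if "v \<in> L" for v
  proof -
    have "(of_real ((norm (pp v))\<^sup>2) :: 'k) = of_real ((norm (pm v))\<^sup>2)"
      using eq[OF that that] by (simp only: ip_self)
    then show ?thesis by (simp only: of_real_eq_iff) simp
  qed
  \<comment> \<open>The formula is forced by \<open>partial_isometry_eq_proj\<close>;
    \<open>restrict\<close> makes \<open>u\<close> an element of the extensional function
    space.\<close>
  define u where "u = restrict (\<lambda>x. 2 *\<^sub>R pm (proj L x)) Vp"
  have b: "bounded_operator Vp Vm u"
    unfolding bounded_operator_def
  proof (intro conjI ballI allI exI)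
    show "u \<in> Vp \<rightarrow>\<^sub>E Vm" using pm_in subspace_Vm by (auto simp: u_def intro: subspace_scaleR)
    show "u (x + y) = u x + u y" if "x \<in> Vp" "y \<in> Vp" for x y
      using that subspace_add[OF subspace_Vp that]
      by (simp add: u_def proj_add[OF PL] pm_add scaleR_right_distrib)
    show "u (scale c x) = scale c (u x)" if "x \<in> Vp" for c x
      using that subspace_scale[OF subspace_Vp that]
      by (simp add: u_def proj_scale[OF PL] pm_scale scale_scaleR_commute)
    show "norm (u x) \<le> 2 * norm x" if "x \<in> Vp" for x
      using that order_trans[OF norm_pm_le norm_proj_le[OF PL]] by (simp add: u_def)
  qed
  \<comment> \<open>The two components of \<open>proj L x\<close> have equal norm, so the projection
    vanishes as soon as its \<open>Vm\<close> component does.\<close>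
  have ker: "ker Vp u = Vp \<inter> orth_compl L"
  proof (intro set_eqI iffI)
    fix x assume x: "x \<in> ker Vp u"
    then have "norm (pm (proj L x)) = 0" by (auto simp: ker_def u_def)
    then have "proj L x = 0"
      using norm_eq[OF proj_in[OF PL], of x] norm_pp_pm[of "proj L x"] by simp
    then show "x \<in> Vp \<inter> orth_compl L"
      using proj_orth[OF PL, of x] x by (auto simp: ker_def)
  next
    fix x assume "x \<in> Vp \<inter> orth_compl L"
    then show "x \<in> ker Vp u"
      using proj_orth_eq_0[OF L, of x] pm_Vp[OF zero_in_Vp] by (simp add: ker_def u_def)
  qed
  have pp_M: "pp v \<in> orth_compl (ker Vp u)" if v: "v \<in> L" for v
  proof -
    have "ip (pp v) n = 0" if "n \<in> ker Vp u" for n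
      using that v ip_Vp_right[of n v] ip_eq_zero_commute[of n v] by (auto simp: ker orth_compl_def)
    then show ?thesis by (simp add: orth_compl_def)
  qed
  \<comment> \<open>On \<open>L\<close> the inner product is twice that of the \<open>V\<^sup>+\<close>-components, so that
    \<open>x\<close> and \<open>pp (2 *\<^sub>R proj L x)\<close> have the same inner products with \<open>L\<close>.\<close>
  have M: "x = pp (2 *\<^sub>R proj L x)" if x: "x \<in> Vp \<inter> orth_compl (ker Vp u)" for x
  proof -
    let ?z = "x - pp (2 *\<^sub>R proj L x)"
    have "ip ?z w = 0" if w: "w \<in> L" for w
    proof -
      have "ip x w = ip (proj L x) w"
        using proj_orth[OF PL, of x] w by (simp add: orth_compl_def ip_diff_left)
      also have "\<dots> = 2 *\<^sub>R ip (pp (proj L x)) (pp w)"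
        using ip_pp_pm[of "proj L x" w] eq[OF proj_in[OF PL] w, of x] by (simp add: scaleR_2)
      also have "\<dots> = ip (pp (2 *\<^sub>R proj L x)) w"
        using ip_Vp_left[OF pp_in, of "2 *\<^sub>R proj L x" w] by (simp add: pp_scaleR ip_scaleR_left)
      finally show ?thesis by (simp add: ip_diff_left)
    qed
    \<comment> \<open>\<open>?z\<close> lies both in the kernel and in its orthogonal complement,
      hence vanishes.\<close>
    then have "?z \<in> ker Vp u"
      using x pp_in subspace_Vp by (auto simp: ker orth_compl_def intro: subspace_diff)
    moreover have "?z \<in> orth_compl (ker Vp u)"
      using x L by (intro subspace_diff subspace_orth_compl pp_M subspace_scaleR proj_in[OF PL]) auto
    ultimately have "ip ?z ?z = 0" unfolding orth_compl_def by blast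
    then show ?thesis by simp
  qed
  have u_M: "u x = pm (2 *\<^sub>R proj L x)" if "x \<in> Vp" for x
    using that by (simp add: u_def pm_scaleR)
  have P2: "2 *\<^sub>R proj L x \<in> L" for x using L by (intro subspace_scaleR proj_in[OF PL])
  have "norm (u x) = norm x" if x: "x \<in> Vp \<inter> orth_compl (ker Vp u)" for x
    using M[OF x] u_M[of x] norm_eq[OF P2, of x] x by simp
  then have pi: "partial_isometry Vp Vm u" using b by (simp add: partial_isometry_def)
  moreover have "L = graph' u"
  proof (intro set_eqI iffI)
    fix v assume "v \<in> graph' u"
    then obtain x where x: "x \<in> Vp \<inter> orth_compl (ker Vp u)" "v = x + u x"
      by (auto simp: graph'_eq[OF b])
    then have "v = 2 *\<^sub>R proj L x"
      using M[OF x(1)] u_M[of x] pp_plus_pm[of "2 *\<^sub>R proj L x"] by auto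
    then show "v \<in> L" using P2 by simp
  next
    fix v assume v: "v \<in> L"
    \<comment> \<open>The remainder \<open>pp v - v/2\<close> is half of \<open>grading v\<close>,
      which isotropy makes orthogonal to \<open>L\<close>.\<close>
    have "proj L (pp v) = (1/2) *\<^sub>R v"
    proof (rule proj_eqI[OF L])
      have "grading v \<in> orth_compl L"
        using iso v by (simp add: isotropic_subspace_def B_def orth_compl_def)
      then have "(1/2) *\<^sub>R grading v \<in> orth_compl L"
        by (intro subspace_scaleR subspace_orth_compl)
      then show "pp v - (1/2) *\<^sub>R v \<in> orth_compl L" by (simp add: pp_def scaleR_right_distrib)
    qed (use L v in \<open>auto intro: subspace_scaleR\<close>)
    then have "u (pp v) = pm v" using u_M[OF pp_in, of v] by simp
    then have "v = pp v + u (pp v)" by (simp add: pp_plus_pm)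
    then show "v \<in> graph' u" using pp_M[OF v] pp_in[of v] by (auto simp: graph'_eq[OF b])
  qed
  ultimately show ?thesis by blast
qed

text \<open>On \<open>Vp\<close> both maps are given by the same projection formula; elsewhere they
  agree by extensionality.\<close>

lemma partial_isometry_graph'_inj:
  assumes u: "partial_isometry Vp Vm u" and w: "partial_isometry Vp Vm w"
    and eq: "graph' u = graph' w"
  shows "u = w"
proof (rule PiE_ext)
  show "u \<in> Vp \<rightarrow>\<^sub>E Vm" "w \<in> Vp \<rightarrow>\<^sub>E Vm"
    using u w by (auto simp: partial_isometry_def bounded_operator_def)
  show "u x = w x" if "x \<in> Vp" for x
    using partial_isometry_eq_proj[OF u that] partial_isometry_eq_proj[OF w that] eq by simp
qed

end

theorem lemma2p3:
  fixes scale :: "'k::real_or_complex \<Rightarrow> 'v::banach \<Rightarrow> 'v"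
    and ip :: "'v \<Rightarrow> 'v \<Rightarrow> 'k"
    and Vp Vm :: "'v set"
  assumes "super_hilbert_space scale ip Vp Vm"
  shows
    "(\<forall>L. closed L \<and> super_hilbert_space.isotropic_subspace scale ip Vp Vm L \<longrightarrow>
        (\<exists>!u. hilbert_space.partial_isometry scale ip Vp Vm u \<and>
              L = super_hilbert_space.graph' ip Vp u)) \<and>
     (\<forall>u. hilbert_space.partial_isometry scale ip Vp Vm u \<longrightarrow>
        closed (super_hilbert_space.graph' ip Vp u) \<and>
        super_hilbert_space.isotropic_subspace scale ip Vp Vm
          (super_hilbert_space.graph' ip Vp u)) \<and>
     (\<forall>L u. closed L \<and> super_hilbert_space.isotropic_subspace scale ip Vp Vm L \<and>
        hilbert_space.partial_isometry scale ip Vp Vm u \<and>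
        L = super_hilbert_space.graph' ip Vp u \<longrightarrow>
        (super_hilbert_space.sub_lagrangian scale ip Vp Vm L \<longleftrightarrow>
           hilbert_space.fredholm scale Vp Vm u) \<and>
        (super_hilbert_space.lagrangian scale ip Vp Vm L \<longleftrightarrow>
           hilbert_space.unitary scale ip Vp Vm u))"
proof -
  interpret super_hilbert_space scale ip Vp Vm by (rule assms)
  show ?thesis
  proof (intro conjI allI impI)
    fix L assume "closed L \<and> isotropic_subspace L"
    then obtain u where "partial_isometry Vp Vm u \<and> L = graph' u"
      using isotropic_imp_graph' by blast
    then show "\<exists>!u. partial_isometry Vp Vm u \<and> L = graph' u"
      by (intro ex1I[of _ u]) (auto intro: partial_isometry_graph'_inj)
  qed (auto simp: closed_graph' isotropic_graph' sub_lagrangian_graph'_iff lagrangian_graph'_iff)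
qed

end
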